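(* Let $m$ be a constant positive integer, $0<\beta<1$ a constant, $\ell=\beta n$, $\alpha=\alpha(n)=O(n)$, and let $p=p(n)$ be admissible. If, for each $n$, $t=t_n$ is an $\alpha$-almost supermagic edge labeling of $K_n$ of $(m,\ell)_p$ type, then $r(p,t)\le 1-\beta$.
   Context: $K_n$ is the complete graph on $n$ vertices with edge set $E$, $\epsilon=\binom n2$, $[a]=\{1,\dots,a\}$; a 1-AP is a set of consecutive integers. For a vertex $v$, $D(v)$ is the set of edges containing $v$. An edge labeling is a bijection $t:E\to[\epsilon]$; $S(t,v)=\{t(e):e\in D(v)\}$ and $s(t,v)=\sum_{e\in D(v)}t(e)$. $t$ is $\alpha$-almost supermagic if $|s(t,u)-s(t,v)|\le\alpha$ for all vertices $u,v$. A $p$-swap of $t$ is a map $\theta$ sending $t$ to another edge labeling $\theta t$ with $|t(e)-\theta t(e)|\le p$ for all $e$. $R(p,t,n)=\max_{\theta}\max_{u\ne v}|s(\theta t,u)-s(\theta t,v)|$ over all $p$-swaps $\theta$; for a family $t=(t_n)$, $r(p,t)=\limsup_{n\to\infty}R(p,t_n,n)/(2pn)$. $p=p(n)$ is admissible if $p=o(n)$ and $p\to\infty$. $S(t,v)$ is of $(m,\ell)_p$ type if there exist at most $m$ pairwise disjoint 1-APs contained in $S(t,v)$, each of length at least $2p$, whose lengths sum to at least $\ell$; $t$ is of $(m,\ell)_p$ type if $S(t,v)$ is of $(m,\ell)_p$ type for every vertex $v$. *)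

theory Defs
  imports Complex_Main "HOL-Library.Landau_Symbols" "HOL-Library.Extended_Real"
    "HOL-Library.Liminf_Limsup" "HOL-Library.Disjoint_Sets"
begin

text \<open>The complete graph \<open>K_n\<close> is realised on the vertex set \<open>{1..n}\<close>; an edge is the set of its
  two end points. A labeling is a function on all sets of naturals, of which only the values
  on the edges of \<open>K_n\<close> matter.\<close>

definition verts :: "nat \<Rightarrow> nat set" where
  "verts n = {1..n}"

definition edges :: "nat \<Rightarrow> nat set set" where
  "edges n = {e. e \<subseteq> verts n \<and> card e = 2}"

definition edges_at :: "nat \<Rightarrow> nat \<Rightarrow> nat set set" where
  "edges_at n v = {e \<in> edges n. v \<in> e}"

type_synonym labeling = "nat set \<Rightarrow> nat"

definition edge_labeling :: "nat \<Rightarrow> labeling \<Rightarrow> bool" where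
  "edge_labeling n t \<longleftrightarrow> bij_betw t (edges n) {1..n choose 2}"

definition label_set :: "nat \<Rightarrow> labeling \<Rightarrow> nat \<Rightarrow> nat set" where
  "label_set n t v = t ` edges_at n v"

definition label_sum :: "nat \<Rightarrow> labeling \<Rightarrow> nat \<Rightarrow> nat" where
  "label_sum n t v = (\<Sum>e\<in>edges_at n v. t e)"

definition almost_supermagic :: "nat \<Rightarrow> real \<Rightarrow> labeling \<Rightarrow> bool" where
  "almost_supermagic n \<alpha> t \<longleftrightarrow>
     (\<forall>u\<in>verts n. \<forall>v\<in>verts n. \<bar>real (label_sum n t u) - real (label_sum n t v)\<bar> \<le> \<alpha>)"

definition p_swap :: "nat \<Rightarrow> real \<Rightarrow> labeling \<Rightarrow> (labeling \<Rightarrow> labeling) \<Rightarrow> bool" where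
  "p_swap n p t \<theta> \<longleftrightarrow>
     edge_labeling n (\<theta> t) \<and> (\<forall>e\<in>edges n. \<bar>real (t e) - real (\<theta> t e)\<bar> \<le> p)"

text \<open>For \<open>n \<ge> 2\<close> and \<open>p \<ge> 0\<close> the maximum below is over a nonempty finite set of values
  (the identity is a \<open>p\<close>-swap); the finitely many other terms of a sequence with
  \<open>p \<rightarrow> \<infinity>\<close> do not influence the limit superior.\<close>

definition swap_R :: "real \<Rightarrow> labeling \<Rightarrow> nat \<Rightarrow> real" where
  "swap_R p t n = Max {\<bar>real (label_sum n (\<theta> t) u) - real (label_sum n (\<theta> t) v)\<bar> | \<theta> u v.
     p_swap n p t \<theta> \<and> u \<in> verts n \<and> v \<in> verts n \<and> u \<noteq> v}"

definition swap_r :: "(nat \<Rightarrow> real) \<Rightarrow> (nat \<Rightarrow> labeling) \<Rightarrow> ereal" where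
  "swap_r p t = limsup (\<lambda>n. ereal (swap_R (p n) (t n) n / (2 * p n * real n)))"

definition admissible :: "(nat \<Rightarrow> real) \<Rightarrow> bool" where
  "admissible p \<longleftrightarrow> p \<in> o(\<lambda>n. real n) \<and> filterlim p at_top sequentially"

definition one_AP :: "nat set \<Rightarrow> bool" where
  "one_AP A \<longleftrightarrow> (\<exists>a b. a \<le> b \<and> A = {a..b})"

text \<open>The length of a 1-AP is its number of terms.\<close>

definition set_of_type :: "nat \<Rightarrow> real \<Rightarrow> real \<Rightarrow> nat set \<Rightarrow> bool" where
  "set_of_type m l p S \<longleftrightarrow>
     (\<exists>\<A>. finite \<A> \<and> card \<A> \<le> m \<and> disjoint \<A> \<and>
        (\<forall>A\<in>\<A>. one_AP A \<and> A \<subseteq> S \<and> 2 * p \<le> real (card A)) \<and>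
        l \<le> (\<Sum>A\<in>\<A>. real (card A)))"

definition labeling_of_type :: "nat \<Rightarrow> nat \<Rightarrow> real \<Rightarrow> real \<Rightarrow> labeling \<Rightarrow> bool" where
  "labeling_of_type n m l p t \<longleftrightarrow> (\<forall>v\<in>verts n. set_of_type m l p (label_set n t v))"

end

theory Submission
  imports Defs
begin

text \<open>
  A \<open>p\<close>-swap permutes the labels and moves each of them by at most \<open>p\<close>. For such a permutation
  \<open>\<pi>\<close> of \<open>{1..N}\<close>, the total displacement \<open>\<Sum>x=1..k. \<pi> x - x\<close> of an initial segment lies in
  \<open>{0..2 * p\<^sup>2}\<close>, because as many labels leave \<open>{1..k}\<close> as enter it, and all this happens within
  distance \<open>p\<close> of \<open>k\<close>. Hence the total displacement on any 1-AP is at most \<open>2 * p\<^sup>2\<close>, whatever its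
  length. At each vertex, the \<open>m\<close> progressions thus contribute only \<open>2 * m * p\<^sup>2 = o(p * n)\<close>, and
  the at most \<open>(1 - \<beta>) * n\<close> remaining labels contribute at most \<open>p\<close> each.
\<close>

lemma initial_displacement_bounds:
  fixes \<pi> :: "nat \<Rightarrow> nat" and p :: real
  assumes bij: "bij_betw \<pi> {1..N} {1..N}"
    and close: "\<And>x. x \<in> {1..N} \<Longrightarrow> \<bar>real (\<pi> x) - real x\<bar> \<le> p"
    and "k \<le> N"
  shows "0 \<le> (\<Sum>x=1..k. real (\<pi> x) - real x)"
    and "(\<Sum>x=1..k. real (\<pi> x) - real x) \<le> 2 * p\<^sup>2"
proof -
  define K where "K = {1..k}"
  define P where "P = \<pi> ` K"
  have KN: "K \<subseteq> {1..N}" using \<open>k \<le> N\<close> by (auto simp: K_def)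
  have inj: "inj_on \<pi> K" using bij KN by (meson bij_betw_def inj_on_subset)
  have fin: "finite K" "finite P" by (auto simp: K_def P_def)
  have card_eq: "card P = card K" using inj by (simp add: P_def card_image)
  have PN: "P \<subseteq> {1..N}" using bij KN by (auto simp: P_def bij_betw_def)
  \<comment> \<open>\<open>P - K\<close> holds the values gained by moving \<open>K\<close>,
    \<open>K - P\<close> those lost. Injectivity of \<open>\<pi>\<close> makes both sets have the
    same size \<open>c\<close>.\<close>
  define c where "c = card (P - K)"
  have c2: "card (K - P) = c"
    using card_eq card_Diff_subset_Int[of P K] card_Diff_subset_Int[of K P] fin
    by (simp add: c_def Int_commute)
  have above: "real k \<le> real y \<and> real y \<le> real k + p \<and> y > k" if "y \<in> P - K" for y
  proof -
    obtain x where x: "x \<in> K" "y = \<pi> x" using \<open>y \<in> P - K\<close> by (auto simp: P_def)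
    have "real y \<le> real x + p" using close[of x] x KN by auto
    moreover have "y > k" using \<open>y \<in> P - K\<close> PN by (auto simp: K_def)
    ultimately show ?thesis using x by (auto simp: K_def)
  qed
  \<comment> \<open>Surjectivity of \<open>\<pi>\<close> gives a lost value \<open>y\<close> a
    preimage. It lies beyond \<open>k\<close>, so \<open>y\<close> is at most \<open>p\<close> below
    \<open>k\<close>.\<close>
  have below: "real k - p \<le> real y \<and> real y \<le> real k" if "y \<in> K - P" for y
  proof -
    have "y \<in> \<pi> ` {1..N}" using \<open>y \<in> K - P\<close> KN bij by (auto simp: bij_betw_def)
    then obtain x where x: "x \<in> {1..N}" "y = \<pi> x" by auto
    then have "x > k" using \<open>y \<in> K - P\<close> by (auto simp: P_def K_def not_less)
    with close[OF x(1)] x \<open>y \<in> K - P\<close> show ?thesis by (auto simp: K_def)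
  qed
  \<comment> \<open>Values in \<open>P \<inter> K\<close> cancel, leaving only the exchanged ones,
    all near \<open>k\<close>.\<close>
  have split: "(\<Sum>x=1..k. real (\<pi> x) - real x) = (\<Sum>y\<in>P - K. real y) - (\<Sum>y\<in>K - P. real y)"
  proof -
    have "(\<Sum>x=1..k. real (\<pi> x) - real x) = (\<Sum>y\<in>P. real y) - (\<Sum>y\<in>K. real y)"
      using inj by (simp add: sum_subtractf P_def K_def sum.reindex)
    moreover have "(\<Sum>y\<in>P. real y) = (\<Sum>y\<in>P - K. real y) + (\<Sum>y\<in>P \<inter> K. real y)"
      using sum.Int_Diff[OF fin(2), of real K] by simp
    moreover have "(\<Sum>y\<in>K. real y) = (\<Sum>y\<in>K - P. real y) + (\<Sum>y\<in>P \<inter> K. real y)"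
      using sum.Int_Diff[OF fin(1), of real P] by (simp add: Int_commute)
    ultimately show ?thesis by simp
  qed
  \<comment> \<open>These four bounds confine the difference to the range from \<open>0\<close> to
    \<open>c * (k + p) - c * (k - p) = 2 * c * p\<close>.\<close>
  have lo1: "real c * real k \<le> (\<Sum>y\<in>P - K. real y)"
    unfolding c_def by (rule sum_bounded_below) (use above in blast)
  have up1: "(\<Sum>y\<in>P - K. real y) \<le> real c * (real k + p)"
    unfolding c_def by (rule sum_bounded_above) (use above in blast)
  have lo2: "real c * (real k - p) \<le> (\<Sum>y\<in>K - P. real y)"
    unfolding c2[symmetric] by (rule sum_bounded_below) (use below in blast)
  have up2: "(\<Sum>y\<in>K - P. real y) \<le> real c * real k"
    unfolding c2[symmetric] by (rule sum_bounded_above) (use below in blast)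
  show "0 \<le> (\<Sum>x=1..k. real (\<pi> x) - real x)" using split lo1 up2 by simp
  show "(\<Sum>x=1..k. real (\<pi> x) - real x) \<le> 2 * p\<^sup>2"
  \<comment> \<open>The sign of \<open>p\<close> is not assumed: when \<open>c\<close> is nonzero, a
    gained value in the window above \<open>k\<close> forces \<open>p \<ge> 0\<close>.\<close>
  proof (cases "c = 0")
    case True
    then have "(\<Sum>x=1..k. real (\<pi> x) - real x) \<le> 0" using split up1 lo2 by simp
    also have "0 \<le> 2 * p\<^sup>2" by simp
    finally show ?thesis .
  next
    case False
    then have "P - K \<noteq> {}" by (metis c_def card.empty)
    then obtain y where "y \<in> P - K" by blast
    then have "p \<ge> 0" using above[of y] by linarith
    \<comment> \<open>The gained values are distinct integers in a window of
      \<open>nat \<lfloor>p\<rfloor>\<close> places, so \<open>c \<le> p\<close> and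
      \<open>2 * c * p\<close> becomes quadratic in \<open>p\<close>.\<close>
    have "P - K \<subseteq> {k<..k + nat \<lfloor>p\<rfloor>}"
    proof
      fix y assume "y \<in> P - K"
      from above[OF this] have "y > k" "real (y - k) \<le> p" by (auto simp: of_nat_diff)
      then have "y - k \<le> nat \<lfloor>p\<rfloor>" by (simp add: le_nat_floor)
      then show "y \<in> {k<..k + nat \<lfloor>p\<rfloor>}" using \<open>y > k\<close> by auto
    qed
    then have "c \<le> nat \<lfloor>p\<rfloor>" unfolding c_def using card_mono[of "{k<..k + nat \<lfloor>p\<rfloor>}" "P - K"] by simp
    then have "real c \<le> p" using \<open>p \<ge> 0\<close> by linarith
    then have "2 * (real c * p) \<le> 2 * (p * p)" using \<open>p \<ge> 0\<close> by (simp add: mult_right_mono)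
    moreover have "(\<Sum>x=1..k. real (\<pi> x) - real x) \<le> 2 * (real c * p)"
      using split up1 lo2 by (simp add: algebra_simps)
    ultimately show ?thesis by (simp add: power2_eq_square)
  qed
qed

text \<open>A 1-AP is the difference of two initial segments. Both displacements are nonnegative and
  at most \<open>2 * p\<^sup>2\<close>, so their difference obeys the same bound, with no
  doubling.\<close>

lemma one_AP_displacement_le:
  fixes \<pi> :: "nat \<Rightarrow> nat" and p :: real
  assumes bij: "bij_betw \<pi> {1..N} {1..N}"
    and close: "\<And>x. x \<in> {1..N} \<Longrightarrow> \<bar>real (\<pi> x) - real x\<bar> \<le> p"
    and "one_AP A" and "A \<subseteq> {1..N}"
  shows "\<bar>\<Sum>x\<in>A. real (\<pi> x) - real x\<bar> \<le> 2 * p\<^sup>2"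
proof -
  obtain a b where ab: "a \<le> b" "A = {a..b}" using \<open>one_AP A\<close> by (auto simp: one_AP_def)
  then have ab': "1 \<le> a" "b \<le> N" using \<open>A \<subseteq> {1..N}\<close> by auto
  \<comment> \<open>Since \<open>1 \<le> a\<close>, the natural subtraction is exact;
    \<open>a = 1\<close> gives an empty initial segment.\<close>
  have "{1..b} = {1..a - 1} \<union> A" "{1..a - 1} \<inter> A = {}" using ab ab' by auto
  then have "(\<Sum>x=1..b. real (\<pi> x) - real x)
      = (\<Sum>x=1..a - 1. real (\<pi> x) - real x) + (\<Sum>x\<in>A. real (\<pi> x) - real x)"
    using ab by (simp add: sum.union_disjoint)
  moreover have "a - 1 \<le> N" using ab ab' by simp
  ultimately show ?thesis
    using initial_displacement_bounds[OF bij close, of b] ab'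
      initial_displacement_bounds[OF bij close, of "a - 1"] by linarith
qed

lemma finite_edges: "finite (edges n)"
  by (rule finite_subset[of _ "Pow (verts n)"]) (auto simp: edges_def verts_def)

lemma edges_at_subset: "edges_at n v \<subseteq> edges n"
  by (auto simp: edges_at_def)

lemma finite_edges_at: "finite (edges_at n v)"
  using finite_edges edges_at_subset by (rule finite_subset[rotated])

text \<open>A vertex has degree \<open>n - 1\<close>; the cruder bound holds for every
  \<open>v\<close> and costs nothing in the limit.\<close>

lemma card_edges_at_le: "card (edges_at n v) \<le> n"
proof -
  have "edges_at n v \<subseteq> (\<lambda>u. {u, v}) ` verts n"
  proof
    fix e assume e: "e \<in> edges_at n v"
    then obtain x y where "e = {x, y}" by (auto simp: edges_at_def edges_def card_2_iff)
    with e show "e \<in> (\<lambda>u. {u, v}) ` verts n"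
      by (auto simp: edges_at_def edges_def insert_commute)
  qed
  then have "card (edges_at n v) \<le> card (verts n)"
    by (rule surj_card_le[rotated]) (simp add: verts_def)
  then show ?thesis by (simp add: verts_def)
qed

text \<open>The labels at \<open>v\<close> split into at most \<open>m\<close> progressions, where
  displacements largely cancel, and at most \<open>n - l\<close> other labels, where each moves by
  at most \<open>p\<close>.\<close>

lemma p_swap_label_sum_close:
  assumes lab: "edge_labeling n t" and swap: "p_swap n p t \<theta>" and "p \<ge> 0"
    and type: "set_of_type m l p (label_set n t v)"
  shows "\<bar>real (label_sum n (\<theta> t) v) - real (label_sum n t v)\<bar> \<le> 2 * real m * p\<^sup>2 + p * (real n - l)"
proof -
  define N where "N = n choose 2"
  define S where "S = label_set n t v"
  \<comment> \<open>This permutation of the labels sends the old label of each edge to its new one,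
    so the displacement bounds apply.\<close>
  define \<pi> where "\<pi> = \<theta> t \<circ> the_inv_into (edges n) t"
  have bt: "bij_betw t (edges n) {1..N}" and bth: "bij_betw (\<theta> t) (edges n) {1..N}"
    using lab swap by (auto simp: edge_labeling_def p_swap_def N_def)
  have inj: "inj_on t (edges n)" using bt by (auto simp: bij_betw_def)
  have \<pi>t: "\<pi> (t e) = \<theta> t e" if "e \<in> edges n" for e
    using that inj by (simp add: \<pi>_def the_inv_into_f_f)
  have bij: "bij_betw \<pi> {1..N} {1..N}"
    unfolding \<pi>_def using bij_betw_the_inv_into[OF bt] bth by (rule bij_betw_trans)
  have close: "\<bar>real (\<pi> x) - real x\<bar> \<le> p" if "x \<in> {1..N}" for x
  proof -
    have "x \<in> t ` edges n" using bt that by (simp add: bij_betw_def)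
    then obtain e where "e \<in> edges n" "x = t e" by auto
    then show ?thesis using swap \<pi>t by (auto simp: p_swap_def abs_minus_commute)
  qed
  have SN: "S \<subseteq> {1..N}" using bt edges_at_subset[of n v]
    by (auto simp: S_def label_set_def bij_betw_def)
  have finS: "finite S" using SN finite_subset by blast
  have injv: "inj_on t (edges_at n v)" using inj edges_at_subset inj_on_subset by blast
  have "card S \<le> n" unfolding S_def label_set_def
    using card_image_le[OF finite_edges_at] card_edges_at_le le_trans by blast
  have diff: "real (label_sum n (\<theta> t) v) - real (label_sum n t v) = (\<Sum>x\<in>S. real (\<pi> x) - real x)"
  proof -
    have "(\<Sum>x\<in>S. real (\<pi> x) - real x) = (\<Sum>e\<in>edges_at n v. real (\<pi> (t e)) - real (t e))"
      unfolding S_def label_set_def using injv by (simp add: sum.reindex)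
    also have "\<dots> = (\<Sum>e\<in>edges_at n v. real (\<theta> t e) - real (t e))"
      by (rule sum.cong) (use \<pi>t edges_at_subset in \<open>auto simp: subset_iff\<close>)
    finally show ?thesis by (simp add: label_sum_def sum_subtractf)
  qed
  obtain \<A> where \<A>: "finite \<A>" "card \<A> \<le> m" "disjoint \<A>" "\<And>A. A \<in> \<A> \<Longrightarrow> one_AP A"
    "\<And>A. A \<in> \<A> \<Longrightarrow> A \<subseteq> S" "l \<le> (\<Sum>A\<in>\<A>. real (card A))"
    using type by (auto simp: set_of_type_def S_def)
  have finA: "finite A" if "A \<in> \<A>" for A using \<A>(5)[OF that] finS finite_subset by blast
  have US: "\<Union>\<A> \<subseteq> S" using \<A>(5) by auto
  \<comment> \<open>Disjointness turns the sum of the lengths into the size of the union.\<close>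
  have cardU: "l \<le> real (card (\<Union>\<A>))"
    using \<A>(6) card_Union_disjoint[of \<A>] \<A>(3) finA by (simp add: disjoint_def pairwise_def disjnt_def)
  have AP: "\<bar>\<Sum>x\<in>\<Union>\<A>. real (\<pi> x) - real x\<bar> \<le> 2 * real m * p\<^sup>2"
  proof -
    have "(\<Sum>x\<in>\<Union>\<A>. real (\<pi> x) - real x) = (\<Sum>A\<in>\<A>. \<Sum>x\<in>A. real (\<pi> x) - real x)"
      using finA \<A>(3) by (subst sum.Union_disjoint) (auto simp: disjoint_def)
    also have "\<bar>\<dots>\<bar> \<le> (\<Sum>A\<in>\<A>. \<bar>\<Sum>x\<in>A. real (\<pi> x) - real x\<bar>)" by (rule sum_abs)
    also have "\<dots> \<le> real (card \<A>) * (2 * p\<^sup>2)"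
      by (rule sum_bounded_above, rule one_AP_displacement_le[OF bij close])
        (use \<A>(4,5) SN in auto)
    also have "\<dots> \<le> real m * (2 * p\<^sup>2)" using \<A>(2) by (intro mult_right_mono) auto
    finally show ?thesis by simp
  qed
  have rest: "\<bar>\<Sum>x\<in>S - \<Union>\<A>. real (\<pi> x) - real x\<bar> \<le> p * (real n - l)"
  proof -
    have "\<bar>\<Sum>x\<in>S - \<Union>\<A>. real (\<pi> x) - real x\<bar> \<le> (\<Sum>x\<in>S - \<Union>\<A>. \<bar>real (\<pi> x) - real x\<bar>)"
      by (rule sum_abs)
    also have "\<dots> \<le> real (card (S - \<Union>\<A>)) * p"
      by (rule sum_bounded_above) (use close SN in auto)
    also have "real (card (S - \<Union>\<A>)) = real (card S) - real (card (\<Union>\<A>))"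
      using US finS by (simp add: card_Diff_subset finite_subset card_mono of_nat_diff)
    also have "(real (card S) - real (card (\<Union>\<A>))) * p \<le> (real n - l) * p"
      using \<open>card S \<le> n\<close> cardU \<open>p \<ge> 0\<close> by (intro mult_right_mono) auto
    finally show ?thesis by (simp add: mult.commute)
  qed
  have "(\<Sum>x\<in>S. real (\<pi> x) - real x)
      = (\<Sum>x\<in>S - \<Union>\<A>. real (\<pi> x) - real x) + (\<Sum>x\<in>\<Union>\<A>. real (\<pi> x) - real x)"
    using US finS by (rule sum.subset_diff)
  then show ?thesis using diff AP rest by linarith
qed

text \<open>A crude bound, serving only to show that the set under \<open>Max\<close> in
  \<open>swap_R\<close> is finite.\<close>

lemma label_sum_le:
  assumes "edge_labeling n t"
  shows "label_sum n t v \<le> n * (n choose 2)"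
proof -
  have "t e \<le> n choose 2" if "e \<in> edges_at n v" for e
    using bij_betwE[of t "edges n"] assms edges_at_subset that by (force simp: edge_labeling_def)
  then have "label_sum n t v \<le> card (edges_at n v) * (n choose 2)"
    unfolding label_sum_def using sum_bounded_above[of "edges_at n v" t "n choose 2"] by simp
  also have "\<dots> \<le> n * (n choose 2)" using card_edges_at_le by simp
  finally show ?thesis .
qed

lemma swap_R_le:
  assumes lab: "edge_labeling n t" and "p \<ge> 0" and "n \<ge> 2"
    and bound: "\<And>\<theta> u v. p_swap n p t \<theta> \<Longrightarrow> u \<in> verts n \<Longrightarrow> v \<in> verts n \<Longrightarrow>
      \<bar>real (label_sum n (\<theta> t) u) - real (label_sum n (\<theta> t) v)\<bar> \<le> B"
  shows "swap_R p t n \<le> B"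
proof -
  let ?X = "{\<bar>real (label_sum n (\<theta> t) u) - real (label_sum n (\<theta> t) v)\<bar> | \<theta> u v.
     p_swap n p t \<theta> \<and> u \<in> verts n \<and> v \<in> verts n \<and> u \<noteq> v}"
  let ?M = "{..n * (n choose 2)}"
  \<comment> \<open>Infinitely many functions \<open>\<theta>\<close> compete, but each value
    depends only on two sums from a bounded range.\<close>
  have "?X \<subseteq> (\<lambda>(i, j). \<bar>real i - real j\<bar>) ` (?M \<times> ?M)"
  proof
    fix x assume "x \<in> ?X"
    then obtain \<theta> u v where x: "p_swap n p t \<theta>"
      "x = \<bar>real (label_sum n (\<theta> t) u) - real (label_sum n (\<theta> t) v)\<bar>" by auto
    then have "edge_labeling n (\<theta> t)" by (simp add: p_swap_def)
    then have "(label_sum n (\<theta> t) u, label_sum n (\<theta> t) v) \<in> ?M \<times> ?M"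
      using label_sum_le by auto
    then show "x \<in> (\<lambda>(i, j). \<bar>real i - real j\<bar>) ` (?M \<times> ?M)" using x(2) by force
  qed
  then have "finite ?X" by (rule finite_subset) auto
  moreover have "?X \<noteq> {}"
  proof -
    \<comment> \<open>The identity swap and the vertices 1 and 2 witness nonemptiness; this is where
      \<open>p \<ge> 0\<close> and \<open>n \<ge> 2\<close> enter.\<close>
    have "p_swap n p t (\<lambda>s. s)" "1 \<in> verts n" "2 \<in> verts n" "(1::nat) \<noteq> 2"
      using lab \<open>p \<ge> 0\<close> \<open>n \<ge> 2\<close> by (auto simp: p_swap_def verts_def)
    then show ?thesis by blast
  qed
  ultimately show ?thesis
    unfolding swap_R_def using bound by (subst Max_le_iff) auto
qed

text \<open>Triangle inequality through \<open>t\<close>: \<open>\<alpha>\<close> for the original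
  sums, plus the swap error at each of the two vertices.\<close>

lemma swap_R_almost_supermagic_le:
  assumes lab: "edge_labeling n t" and magic: "almost_supermagic n \<alpha> t"
    and type: "labeling_of_type n m l p t" and "p \<ge> 0" and "n \<ge> 2"
  shows "swap_R p t n \<le> \<alpha> + 4 * real m * p\<^sup>2 + 2 * p * (real n - l)"
proof (rule swap_R_le[OF lab \<open>p \<ge> 0\<close> \<open>n \<ge> 2\<close>])
  fix \<theta> u v assume *: "p_swap n p t \<theta>" "u \<in> verts n" "v \<in> verts n"
  have close: "\<bar>real (label_sum n (\<theta> t) w) - real (label_sum n t w)\<bar> \<le> 2 * real m * p\<^sup>2 + p * (real n - l)"
    if "w \<in> verts n" for w
    using p_swap_label_sum_close[OF lab *(1) \<open>p \<ge> 0\<close>] type that by (simp add: labeling_of_type_def)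
  have "\<bar>real (label_sum n t u) - real (label_sum n t v)\<bar> \<le> \<alpha>"
    using magic * by (auto simp: almost_supermagic_def)
  with close[OF *(2)] close[OF *(3)]
  show "\<bar>real (label_sum n (\<theta> t) u) - real (label_sum n (\<theta> t) v)\<bar>
      \<le> \<alpha> + 4 * real m * p\<^sup>2 + 2 * p * (real n - l)" by linarith
qed

theorem theorem5p9:
  fixes m :: nat and \<beta> :: real and \<alpha> p :: "nat \<Rightarrow> real" and t :: "nat \<Rightarrow> labeling"
  assumes "m > 0"
    and "0 < \<beta>" and "\<beta> < 1"
    and "\<alpha> \<in> O(\<lambda>n. real n)"
    and "admissible p"
    and "\<forall>\<^sub>F n in sequentially. edge_labeling n (t n) \<and> almost_supermagic n (\<alpha> n) (t n) \<and>
           labeling_of_type n m (\<beta> * real n) (p n) (t n)"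
  shows "swap_r p t \<le> ereal (1 - \<beta>)"
proof -
  have po: "p \<in> o(\<lambda>n. real n)" and p_top: "filterlim p at_top sequentially"
    using \<open>admissible p\<close> by (auto simp: admissible_def)
  obtain C where C: "\<forall>\<^sub>F n in sequentially. norm (\<alpha> n) \<le> C * norm (real n)"
    using \<open>\<alpha> \<in> O(\<lambda>n. real n)\<close> by (elim landau_o.bigE)
  \<comment> \<open>This is the bound on \<open>swap_R\<close>, with \<open>C * n\<close> for
    \<open>\<alpha> n\<close>, divided by \<open>2 * p n * n\<close>. The first term vanishes
    because \<open>p\<close> tends to infinity, the second because \<open>p = o(n)\<close>.

    @ STEP 355 placeholder\<close>
  define g where "g n = C / 2 * inverse (p n) + 2 * real m * (p n / real n) + (1 - \<beta>)" for n
  have "(\<lambda>n. inverse (p n)) \<longlonglongrightarrow> 0"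
    using tendsto_inverse_0_at_top[OF p_top] .
  moreover have "(\<lambda>n. p n / real n) \<longlonglongrightarrow> 0" using smalloD_tendsto[OF po] .
  ultimately have "g \<longlonglongrightarrow> C / 2 * 0 + 2 * real m * 0 + (1 - \<beta>)"
    unfolding g_def by (intro tendsto_intros)
  then have lim: "limsup (\<lambda>n. ereal (g n)) = ereal (1 - \<beta>)"
    by (intro lim_imp_Limsup) auto
  have "\<forall>\<^sub>F n in sequentially. p n > 0" using p_top by (simp add: filterlim_at_top_dense)
  with assms(6) C eventually_ge_at_top[of 2]
  have "\<forall>\<^sub>F n in sequentially. ereal (swap_R (p n) (t n) n / (2 * p n * real n)) \<le> ereal (g n)"
  proof eventually_elim
    case (elim n)
    have pos: "2 * p n * real n > 0" using elim by simp
    have "swap_R (p n) (t n) n \<le> \<alpha> n + 4 * real m * (p n)\<^sup>2 + 2 * p n * (real n - \<beta> * real n)"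
      using elim by (intro swap_R_almost_supermagic_le) auto
    also have "\<dots> \<le> C * real n + 4 * real m * (p n)\<^sup>2 + 2 * p n * (real n - \<beta> * real n)"
      using elim by simp
    also have "\<dots> = g n * (2 * p n * real n)"
      using elim by (simp add: g_def field_simps power2_eq_square)
    finally show ?case using pos by (simp add: divide_le_eq)
  qed
  then have "swap_r p t \<le> limsup (\<lambda>n. ereal (g n))"
    unfolding swap_r_def by (rule Limsup_mono)
  with lim show ?thesis by simp
qed

end
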